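(* For any numerical semigroup $H$, the defining ideal $I_H$ is generated by RF-relations, i.e. by binomials of the form $F(\mathbf m_p-\mathbf m_q)$ where $\mathbf m_p,\mathbf m_q$ ($p\ne q$) are two rows of some RF-matrix of some pseudo-Frobenius number $f\in\mathrm{PF}(H)$ (both $f$ and the RF-matrix may vary with the binomial).
   Context: A numerical semigroup is an additive submonoid $H$ of $\mathbb N=\{0,1,2,\dots\}$ with finite complement; let $n_1,\dots,n_e$ be its minimal generators. $\mathrm{PF}(H)$ is the set of pseudo-Frobenius numbers: $f\in\mathbb Z\setminus H$ with $f+n_i\in H$ for all $i$. For a field $\Bbbk$, the defining (toric) ideal $I_H$ is the kernel of $\Bbbk[x_1,\dots,x_e]\to\Bbbk[t]$, $x_i\mapsto t^{n_i}$. For $\mathbf v\in\mathbb Z^e$ write $\mathbf v=\mathbf v^+-\mathbf v^-$ with $\mathbf v^\pm\in\mathbb N^e$ of disjoint supports, and $F(\mathbf v)=\mathbf x^{\mathbf v^+}-\mathbf x^{\mathbf v^-}$. For $f\in\mathrm{PF}(H)$, an RF-matrix of $f$ is an integer $e\times e$ matrix $(m_{ij})$ with $m_{ii}=-1$, $m_{ij}\ge0$ for $i\ne j$, and $\sum_j m_{ij}n_j=f$ for all $i$ (it need not be unique). *)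

theory Defs
  imports
    "HOL-Library.Poly_Mapping"
    "HOL-Computational_Algebra.Polynomial"
    "HOL-Algebra.Ideal"
begin

definition add_submonoid :: "nat set \<Rightarrow> bool" where
  "add_submonoid M \<longleftrightarrow> 0 \<in> M \<and> (\<forall>x\<in>M. \<forall>y\<in>M. x + y \<in> M)"

definition numerical_semigroup :: "nat set \<Rightarrow> bool" where
  "numerical_semigroup H \<longleftrightarrow> add_submonoid H \<and> finite (- H)"

text \<open>All families of length \<open>e\<close> are functions on \<open>nat\<close> of which only the values at
  the indices \<open>0, \<dots>, e - 1\<close> matter.\<close>

definition minimal_generators :: "nat set \<Rightarrow> nat \<Rightarrow> (nat \<Rightarrow> nat) \<Rightarrow> bool" where
  "minimal_generators H e n \<longleftrightarrow>
     inj_on n {..<e} \<and>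
     add_submonoid hull (n ` {..<e}) = H \<and>
     (\<forall>A. A \<subset> n ` {..<e} \<longrightarrow> add_submonoid hull A \<noteq> H)"

definition PF :: "nat set \<Rightarrow> nat \<Rightarrow> (nat \<Rightarrow> nat) \<Rightarrow> int set" where
  "PF H e n = {f. f \<notin> int ` H \<and> (\<forall>i<e. f + int (n i) \<in> int ` H)}"

definition RF_matrix :: "nat \<Rightarrow> (nat \<Rightarrow> nat) \<Rightarrow> int \<Rightarrow> (nat \<Rightarrow> nat \<Rightarrow> int) \<Rightarrow> bool" where
  "RF_matrix e n f m \<longleftrightarrow>
     (\<forall>i<e. m i i = -1) \<and>
     (\<forall>i<e. \<forall>j<e. i \<noteq> j \<longrightarrow> m i j \<ge> 0) \<and>
     (\<forall>i<e. (\<Sum>j<e. m i j * int (n j)) = f)"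

text \<open>A polynomial is a finitely supported map from exponents to coefficients, an exponent
  being a finitely supported map from variable indices to \<open>nat\<close>. The product of
  \<^typ>\<open>(nat \<Rightarrow>\<^sub>0 nat) \<Rightarrow>\<^sub>0 'k::comm_ring_1\<close> is the convolution product.\<close>

type_synonym 'k mpoly = "(nat \<Rightarrow>\<^sub>0 nat) \<Rightarrow>\<^sub>0 'k"

definition Var :: "nat \<Rightarrow> 'k::field mpoly" where
  "Var i = Poly_Mapping.single (Poly_Mapping.single i 1) 1"

text \<open>The ring \<open>k[x\<^sub>0, \<dots>, x\<^sub>e\<^sub>-\<^sub>1]\<close>.\<close>

definition poly_ring :: "nat \<Rightarrow> 'k::field mpoly ring" where
  "poly_ring e =
     \<lparr>carrier = {p. \<forall>u\<in>Poly_Mapping.keys p. Poly_Mapping.keys u \<subseteq> {..<e}},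
      mult = (*), one = 1, zero = 0, add = (+)\<rparr>"

text \<open>The \<open>k\<close>-algebra homomorphism \<open>x\<^sub>i \<mapsto> t ^ n\<^sub>i\<close> to \<open>k[t]\<close>.\<close>

definition toric_map :: "(nat \<Rightarrow> nat) \<Rightarrow> 'k::field mpoly \<Rightarrow> 'k poly" where
  "toric_map n p =
     (\<Sum>u\<in>Poly_Mapping.keys p. smult (Poly_Mapping.lookup p u)
        (\<Prod>i\<in>Poly_Mapping.keys u. monom 1 (n i) ^ Poly_Mapping.lookup u i))"

definition toric_ideal :: "nat \<Rightarrow> (nat \<Rightarrow> nat) \<Rightarrow> 'k::field mpoly set" where
  "toric_ideal e n = {p \<in> carrier (poly_ring e). toric_map n p = 0}"

text \<open>Since \<^const>\<open>nat\<close> sends negative integers to \<open>0\<close>, the two exponents below are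
  the positive and negative parts of \<open>v\<close>.\<close>

definition F_binomial :: "nat \<Rightarrow> (nat \<Rightarrow> int) \<Rightarrow> 'k::field mpoly" where
  "F_binomial e v = (\<Prod>i<e. Var i ^ nat (v i)) - (\<Prod>i<e. Var i ^ nat (- v i))"

definition RF_relations :: "nat set \<Rightarrow> nat \<Rightarrow> (nat \<Rightarrow> nat) \<Rightarrow> 'k::field mpoly set" where
  "RF_relations H e n =
     {F_binomial e (\<lambda>j. m p j - m q j) | f m p q.
        f \<in> PF H e n \<and> RF_matrix e n f m \<and> p < e \<and> q < e \<and> p \<noteq> q}"

end

theory Submission
  imports Defs
begin

text \<open>
  Let \<open>J\<close> be an ideal containing all RF-relations. By strong induction on \<open>b\<close>, any two monomials
  \<open>x\<^sup>u\<close>, \<open>x\<^sup>w\<close> of degree \<open>b\<close> are congruent modulo \<open>J\<close>. If they have a common variable, divide by it.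
  Otherwise choose \<open>x\<^sub>i\<close> dividing \<open>x\<^sup>u\<close> and \<open>x\<^sub>j\<close> dividing \<open>x\<^sup>w\<close>. If \<open>b - n\<^sub>i - n\<^sub>j \<in> H\<close>, some monomial
  of degree \<open>b\<close> is divisible by \<open>x\<^sub>i x\<^sub>j\<close> and shares a variable with both. If not, there are
  \<open>h \<in> H\<close> and a pseudo-Frobenius number \<open>f = b - n\<^sub>i - n\<^sub>j + h\<close>. With \<open>c\<close> a factorization of \<open>h\<close>,
  \<open>w - e\<^sub>j + c\<close> and \<open>u - e\<^sub>i + c\<close> are factorizations of \<open>f + n\<^sub>i\<close> and \<open>f + n\<^sub>j\<close>, hence
  \<open>w - e\<^sub>j + c - e\<^sub>i\<close> and \<open>u - e\<^sub>i + c - e\<^sub>j\<close> are rows of an RF-matrix of \<open>f\<close>; their difference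
  is \<open>w - u\<close>.
\<close>

section \<open>Weighted degrees and the toric map\<close>

text \<open>The degree of \<open>x^u\<close> in the grading that gives \<open>x_i\<close> degree
  \<open>n i\<close>, hence the exponent of \<open>t\<close> in its image. An exponent vector
  \<open>u\<close> is thereby a factorization of \<open>wdeg n u\<close>.\<close>

definition wdeg :: "(nat \<Rightarrow> nat) \<Rightarrow> (nat \<Rightarrow>\<^sub>0 nat) \<Rightarrow> nat" where
  "wdeg n u = (\<Sum>i\<in>Poly_Mapping.keys u. Poly_Mapping.lookup u i * n i)"

lemma wdeg_zero [simp]: "wdeg n 0 = 0"
  by (simp add: wdeg_def)

lemma wdeg_single [simp]: "wdeg n (Poly_Mapping.single i k) = k * n i"
  by (simp add: wdeg_def)

lemma wdeg_add: "wdeg n (u + v) = wdeg n u + wdeg n v"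
  unfolding wdeg_def
  by (rule setsum_keys_plus_distrib[of "\<lambda>i k. k * n i"]) (auto simp: algebra_simps)

lemma wdeg_sum: "wdeg n (\<Sum>x\<in>A. g x) = (\<Sum>x\<in>A. wdeg n (g x))"
  by (induction A rule: infinite_finite_induct) (auto simp: wdeg_add)

lemma wdeg_eq_sum:
  assumes "Poly_Mapping.keys u \<subseteq> A" "finite A"
  shows "wdeg n u = (\<Sum>i\<in>A. Poly_Mapping.lookup u i * n i)"
  unfolding wdeg_def using assms by (intro sum.mono_neutral_left) (auto simp: in_keys_iff)

lemma keys_add_nat:
  fixes u v :: "'a \<Rightarrow>\<^sub>0 nat"
  shows "Poly_Mapping.keys (u + v) = Poly_Mapping.keys u \<union> Poly_Mapping.keys v"
  by (auto simp: in_keys_iff lookup_add)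

text \<open>Division of a monomial by one of its variables: truncated subtraction is exact because
  the exponent at \<open>i\<close> is positive.\<close>

lemma obtain_single_add:
  fixes u :: "'a \<Rightarrow>\<^sub>0 nat"
  assumes "i \<in> Poly_Mapping.keys u"
  obtains u' where "u = Poly_Mapping.single i 1 + u'"
proof
  show "u = Poly_Mapping.single i 1 + (u - Poly_Mapping.single i 1)"
    using assms
    by (intro poly_mapping_eqI)
      (auto simp: lookup_add lookup_minus lookup_single when_def in_keys_iff)
qed

lemma poly_mapping_eq_sum_single:
  assumes "Poly_Mapping.keys p \<subseteq> A" "finite A"
  shows "(\<Sum>u\<in>A. Poly_Mapping.single u (Poly_Mapping.lookup p u)) = p"
  using assms
  by (intro poly_mapping_eqI) (auto simp: lookup_sum lookup_single when_def in_keys_iff)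

lemma prod_monom:
  "(\<Prod>i\<in>A. monom (1 :: 'k::comm_semiring_1) (g i)) = monom 1 (\<Sum>i\<in>A. g i)"
  by (induction A rule: infinite_finite_induct) (auto simp: mult_monom)

lemma toric_map_eq_sum:
  "toric_map n p = (\<Sum>u\<in>Poly_Mapping.keys p. monom (Poly_Mapping.lookup p u) (wdeg n u))"
  by (simp add: toric_map_def monom_power prod_monom wdeg_def smult_monom mult.commute)

lemma toric_map_zero [simp]: "toric_map n 0 = 0"
  by (simp add: toric_map_eq_sum)

lemma toric_map_single [simp]: "toric_map n (Poly_Mapping.single u c) = monom c (wdeg n u)"
  by (simp add: toric_map_eq_sum)

lemma toric_map_add: "toric_map n (p + q) = toric_map n p + toric_map n q"
  unfolding toric_map_eq_sum
  by (rule setsum_keys_plus_distrib[of "\<lambda>u c. monom c (wdeg n u)"]) (auto simp: add_monom)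

lemma toric_map_uminus: "toric_map n (- p) = - toric_map n p"
  using toric_map_add[of n p "- p"] by (simp add: eq_neg_iff_add_eq_0 add.commute)

lemma toric_map_diff: "toric_map n (p - q) = toric_map n p - toric_map n q"
  using toric_map_add[of n p "- q"] by (simp add: toric_map_uminus)

lemma toric_map_sum: "toric_map n (\<Sum>x\<in>A. g x) = (\<Sum>x\<in>A. toric_map n (g x))"
  by (induction A rule: infinite_finite_induct) (auto simp: toric_map_add)

text \<open>By bilinearity it suffices to compare products of single terms, where multiplicativity
  is additivity of \<open>wdeg\<close>.\<close>

lemma toric_map_mult: "toric_map n (p * q) = toric_map n p * toric_map n q"
proof -
  let ?s = "\<lambda>p :: 'a mpoly. \<lambda>u. Poly_Mapping.single u (Poly_Mapping.lookup p u)"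
  have "toric_map n (p * q) =
      toric_map n ((\<Sum>u\<in>Poly_Mapping.keys p. ?s p u) * (\<Sum>v\<in>Poly_Mapping.keys q. ?s q v))"
    by (simp add: poly_mapping_eq_sum_single)
  also have "\<dots> = toric_map n p * toric_map n q"
    by (simp add: sum_product toric_map_sum mult_single wdeg_add mult_monom
        toric_map_eq_sum[of n p] toric_map_eq_sum[of n q])
  finally show ?thesis .
qed

section \<open>The polynomial ring and the toric ideal\<close>

lemma poly_ring_simps [simp]:
  "mult (poly_ring e) = (*)" "one (poly_ring e) = 1"
  "zero (poly_ring e) = 0" "add (poly_ring e) = (+)"
  by (simp_all add: poly_ring_def)

lemma mem_carrier_poly_ring:
  "p \<in> carrier (poly_ring e) \<longleftrightarrow> (\<forall>u\<in>Poly_Mapping.keys p. Poly_Mapping.keys u \<subseteq> {..<e})"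
  by (simp add: poly_ring_def)

lemma single_mem_carrier:
  "Poly_Mapping.keys u \<subseteq> {..<e} \<Longrightarrow> Poly_Mapping.single u c \<in> carrier (poly_ring e)"
  by (simp add: mem_carrier_poly_ring)

lemma add_mem_carrier:
  "p \<in> carrier (poly_ring e) \<Longrightarrow> q \<in> carrier (poly_ring e) \<Longrightarrow> p + q \<in> carrier (poly_ring e)"
  using keys_add[of p q] unfolding mem_carrier_poly_ring by blast

lemma uminus_mem_carrier: "p \<in> carrier (poly_ring e) \<Longrightarrow> - p \<in> carrier (poly_ring e)"
  by (simp add: mem_carrier_poly_ring in_keys_iff)

lemma diff_mem_carrier:
  "p \<in> carrier (poly_ring e) \<Longrightarrow> q \<in> carrier (poly_ring e) \<Longrightarrow> p - q \<in> carrier (poly_ring e)"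
  using add_mem_carrier[of p e "- q"] uminus_mem_carrier[of q e] by simp

lemma mult_mem_carrier:
  assumes "p \<in> carrier (poly_ring e)" "q \<in> carrier (poly_ring e)"
  shows "p * q \<in> carrier (poly_ring e)"
  unfolding mem_carrier_poly_ring
proof
  fix w assume "w \<in> Poly_Mapping.keys (p * q)"
  then obtain u v where "w = u + v" "u \<in> Poly_Mapping.keys p" "v \<in> Poly_Mapping.keys q"
    using keys_mult[of p q] by blast
  then show "Poly_Mapping.keys w \<subseteq> {..<e}"
    using assms by (auto simp: mem_carrier_poly_ring keys_add_nat)
qed

lemma cring_poly_ring: "cring (poly_ring e :: 'k::field mpoly ring)"
proof (rule cringI)
  show "abelian_group (poly_ring e :: 'k mpoly ring)"
  proof (rule abelian_groupI; simp add: add_mem_carrier algebra_simps)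
    show "(0 :: 'k mpoly) \<in> carrier (poly_ring e)"
      by (simp add: mem_carrier_poly_ring)
    show "\<exists>y\<in>carrier (poly_ring e). x + y = 0" if "x \<in> carrier (poly_ring e)" for x :: "'k mpoly"
      using that uminus_mem_carrier[of x e] by (intro bexI[of _ "- x"]) auto
  qed
  show "comm_monoid (poly_ring e :: 'k mpoly ring)"
    by (rule comm_monoidI)
      (auto simp: mult_mem_carrier algebra_simps, simp add: mem_carrier_poly_ring)
qed (simp add: algebra_simps)

lemma ideal_toric_ideal: "ideal (toric_ideal e n :: 'k::field mpoly set) (poly_ring e)"
proof -
  interpret R: cring "poly_ring e :: 'k mpoly ring"
    by (rule cring_poly_ring)
  have minus: "\<ominus>\<^bsub>poly_ring e\<^esub> p = - p" if "p \<in> carrier (poly_ring e)" for p :: "'k mpoly"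
    using that by (intro R.minus_equality) (auto simp: uminus_mem_carrier)
  show ?thesis
  proof (rule idealI)
    show "subgroup (toric_ideal e n :: 'k mpoly set) (add_monoid (poly_ring e))"
    proof (rule R.add.subgroupI)
      show "(toric_ideal e n :: 'k mpoly set) \<noteq> {}"
        using R.zero_closed by (auto simp: toric_ideal_def intro!: exI[of _ 0])
    qed (auto simp: toric_ideal_def minus toric_map_add toric_map_uminus
        intro: add_mem_carrier uminus_mem_carrier)
  qed (auto simp: R.ring_axioms toric_ideal_def toric_map_mult mult_mem_carrier)
qed

section \<open>Reduction of the toric ideal to binomials\<close>

context
  fixes e :: nat and J :: "'k::field mpoly set"
  assumes J: "ideal J (poly_ring e)"
begin

lemma ideal_zero: "0 \<in> J"
  using additive_subgroup.zero_closed[OF ideal.axioms(1)[OF J]] by simp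

lemma ideal_add: "p \<in> J \<Longrightarrow> q \<in> J \<Longrightarrow> p + q \<in> J"
  using additive_subgroup.a_closed[OF ideal.axioms(1)[OF J], of p q] by simp

lemma ideal_mult: "p \<in> carrier (poly_ring e) \<Longrightarrow> q \<in> J \<Longrightarrow> p * q \<in> J"
  using ideal.I_l_closed[OF J, of q p] by simp

text \<open>Cancel one term \<open>c x\<^sup>u\<close> of \<open>p\<close> against another term of the same degree, which exists
  because the coefficients of \<open>p\<close> in each degree sum to \<open>0\<close>.\<close>

lemma toric_ideal_subset_ideal:
  assumes binomials: "\<And>u w. Poly_Mapping.keys u \<subseteq> {..<e} \<Longrightarrow> Poly_Mapping.keys w \<subseteq> {..<e} \<Longrightarrow>
      wdeg n u = wdeg n w \<Longrightarrow> Poly_Mapping.single u 1 - Poly_Mapping.single w 1 \<in> J"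
  shows "toric_ideal e n \<subseteq> J"
proof
  fix p :: "'k mpoly"
  assume "p \<in> toric_ideal e n"
  then show "p \<in> J"
  proof (induction "card (Poly_Mapping.keys p)" arbitrary: p rule: less_induct)
    case less
    show ?case
    proof (cases "p = 0")
      case True
      then show ?thesis by (simp add: ideal_zero)
    next
      case False
      then obtain u where u: "u \<in> Poly_Mapping.keys p"
        by (metis lookup_zero not_in_keys_iff_lookup_eq_zero poly_mapping_eqI)
      let ?c = "Poly_Mapping.lookup p u"
      let ?D = "{v \<in> Poly_Mapping.keys p. wdeg n v = wdeg n u}"
      have p: "p \<in> carrier (poly_ring e)" "toric_map n p = 0"
        using less.prems by (auto simp: toric_ideal_def)
      have "0 = coeff (toric_map n p) (wdeg n u)"
        by (simp add: p)
      also have "\<dots> = (\<Sum>v\<in>?D. Poly_Mapping.lookup p v)"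
        by (simp add: toric_map_eq_sum coeff_sum sum.inter_filter)
      also have "\<dots> = ?c + (\<Sum>v\<in>?D - {u}. Poly_Mapping.lookup p v)"
        using u by (intro sum.remove) auto
      finally have "?D - {u} \<noteq> {}"
        using u by (metis add.right_neutral in_keys_iff sum.empty)
      then obtain v where v: "v \<in> Poly_Mapping.keys p" "wdeg n v = wdeg n u" "v \<noteq> u"
        by blast
      \<comment> \<open>\<open>single 0 ?c\<close> is the constant polynomial with value
        \<open>?c\<close>, so \<open>b\<close> is a scalar multiple of a binomial in
        \<open>J\<close>.\<close>
      define b where "b = Poly_Mapping.single 0 ?c *
          (Poly_Mapping.single u 1 - Poly_Mapping.single v 1 :: 'k mpoly)"
      have b: "b = Poly_Mapping.single u ?c - Poly_Mapping.single v ?c"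
        by (simp add: b_def right_diff_distrib mult_single)
      have keys: "Poly_Mapping.keys u \<subseteq> {..<e}" "Poly_Mapping.keys v \<subseteq> {..<e}"
        using p u v by (auto simp: mem_carrier_poly_ring)
      have "b \<in> J"
        unfolding b_def using keys v
        by (intro ideal_mult binomials single_mem_carrier) auto
      \<comment> \<open>The term at \<open>u\<close> cancels, and the other term of \<open>b\<close>
        sits at \<open>v\<close>, which already occurs in \<open>p\<close>; no new exponent
        appears.\<close>
      have "Poly_Mapping.keys (p - b) \<subseteq> Poly_Mapping.keys p - {u}"
        using u v(1,3)
        by (auto simp: b in_keys_iff lookup_minus lookup_single when_def split: if_splits)
      then have "card (Poly_Mapping.keys (p - b)) < card (Poly_Mapping.keys p)"
        using u by (intro psubset_card_mono) auto
      moreover have "p - b \<in> toric_ideal e n"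
        using p keys v(2)
        by (auto simp: toric_ideal_def toric_map_diff b intro!: diff_mem_carrier single_mem_carrier)
      ultimately have "p - b \<in> J"
        by (rule less.hyps)
      then show ?thesis
        using ideal_add[OF _ \<open>b \<in> J\<close>, of "p - b"] by simp
    qed
  qed
qed

end

section \<open>RF-relations\<close>

lemma F_binomial_eq:
  "(F_binomial e v :: 'k::field mpoly) =
    Poly_Mapping.single (\<Sum>i<e. Poly_Mapping.single i (nat (v i))) 1 -
    Poly_Mapping.single (\<Sum>i<e. Poly_Mapping.single i (nat (- v i))) 1"
proof -
  have pow: "(Var i :: 'k mpoly) ^ k = Poly_Mapping.single (Poly_Mapping.single i k) 1" for i k
    by (induction k) (auto simp: Var_def mult_single simp flip: single_add)
  have "(\<Prod>i\<in>A. Poly_Mapping.single (g i) (1 :: 'k)) = Poly_Mapping.single (\<Sum>i\<in>A. g i) 1"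
    for A :: "nat set" and g :: "nat \<Rightarrow> nat \<Rightarrow>\<^sub>0 nat"
    by (induction A rule: infinite_finite_induct) (auto simp: mult_single)
  then show ?thesis
    by (simp add: F_binomial_def pow)
qed

text \<open>With disjoint supports nothing cancels in \<open>u - w\<close>, so \<open>u\<close> and
  \<open>w\<close> are its positive and negative parts.\<close>

lemma F_binomial_disjoint:
  assumes "Poly_Mapping.keys u \<subseteq> {..<e}" "Poly_Mapping.keys w \<subseteq> {..<e}"
    and disj: "Poly_Mapping.keys u \<inter> Poly_Mapping.keys w = {}"
  shows "F_binomial e (\<lambda>l. int (Poly_Mapping.lookup u l) - int (Poly_Mapping.lookup w l)) =
    Poly_Mapping.single u 1 - Poly_Mapping.single w 1"
proof -
  have "Poly_Mapping.lookup u l = 0 \<or> Poly_Mapping.lookup w l = 0" for l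
    using disj by (auto simp: in_keys_iff)
  then have "nat (int (Poly_Mapping.lookup u l) - int (Poly_Mapping.lookup w l)) = Poly_Mapping.lookup u l"
    and "nat (- (int (Poly_Mapping.lookup u l) - int (Poly_Mapping.lookup w l))) = Poly_Mapping.lookup w l"
    for l by (metis diff_0_right int_ops(1) minus_diff_eq nat_0_iff nat_int diff_0
          neg_le_0_iff_le of_nat_0_le_iff)+
  then show ?thesis
    unfolding F_binomial_eq using assms by (simp add: poly_mapping_eq_sum_single)
qed

text \<open>Two rows have the same weighted sum \<open>f\<close>, so their difference has weighted
  sum 0 and its positive and negative parts have equal degree.\<close>

lemma RF_relations_subset_toric_ideal:
  "(RF_relations H e n :: 'k::field mpoly set) \<subseteq> toric_ideal e n"
proof
  fix b :: "'k mpoly"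
  assume "b \<in> RF_relations H e n"
  then obtain f m p q where b: "b = F_binomial e (\<lambda>j. m p j - m q j)"
    and m: "RF_matrix e n f m" "p < e" "q < e"
    by (auto simp: RF_relations_def)
  define v where "v = (\<lambda>j. m p j - m q j)"
  have "(\<Sum>j<e. v j * int (n j)) = 0"
    using m by (simp add: v_def RF_matrix_def left_diff_distrib sum_subtractf)
  moreover have "v j = int (nat (v j)) - int (nat (- v j))" for j
    by simp
  ultimately have "(\<Sum>j<e. (int (nat (v j)) - int (nat (- v j))) * int (n j)) = 0"
    by simp
  then have "int (\<Sum>j<e. nat (v j) * n j) = int (\<Sum>j<e. nat (- v j) * n j)"
    unfolding left_diff_distrib sum_subtractf by simp
  then have "toric_map n b = 0"
    by (simp only: of_nat_eq_iff b F_binomial_eq toric_map_diff toric_map_single wdeg_sum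
        wdeg_single v_def diff_self)
  moreover have "Poly_Mapping.keys (\<Sum>i<e. Poly_Mapping.single i (g i) :: nat \<Rightarrow>\<^sub>0 nat) \<subseteq> {..<e}" for g
    by (auto simp: in_keys_iff lookup_sum lookup_single when_def split: if_splits)
  then have "b \<in> carrier (poly_ring e)"
    unfolding b F_binomial_eq by (intro diff_mem_carrier single_mem_carrier)
  ultimately show "b \<in> toric_ideal e n"
    by (simp add: toric_ideal_def)
qed

section \<open>Numerical semigroups and their factorizations\<close>

lemma add_submonoid_hull_zero: "0 \<in> add_submonoid hull A"
  by (auto simp: hull_def add_submonoid_def)

lemma add_submonoid_sum:
  assumes "add_submonoid M" "\<And>i. i \<in> A \<Longrightarrow> g i \<in> M"
  shows "(\<Sum>i\<in>A. g i) \<in> M"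
  using assms(2)
  by (induction A rule: infinite_finite_induct) (use assms(1) in \<open>auto simp: add_submonoid_def\<close>)

lemma add_submonoid_mult: "add_submonoid M \<Longrightarrow> x \<in> M \<Longrightarrow> k * x \<in> M"
  by (induction k) (auto simp: add_submonoid_def)

text \<open>Makes factorizations available as exponent vectors: the degrees form a submonoid
  containing the generators, and each degree is a sum of multiples of generators.\<close>

lemma add_submonoid_hull_image:
  "add_submonoid hull (n ` {..<e}) = wdeg n ` {u. Poly_Mapping.keys u \<subseteq> {..<e}}" (is "_ = ?W")
proof (rule hull_unique)
  show "n ` {..<e} \<subseteq> ?W"
    by (auto intro!: image_eqI[of _ _ "Poly_Mapping.single _ 1"])
  have "0 \<in> ?W"
    by (intro image_eqI[of _ _ 0]) auto
  moreover have "wdeg n u + wdeg n v \<in> ?W"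
    if "Poly_Mapping.keys u \<subseteq> {..<e}" "Poly_Mapping.keys v \<subseteq> {..<e}" for u v
    using that by (intro image_eqI[of _ _ "u + v"]) (auto simp: wdeg_add keys_add_nat)
  ultimately show "add_submonoid ?W"
    by (auto simp: add_submonoid_def)
next
  fix M assume "n ` {..<e} \<subseteq> M" "add_submonoid M"
  then show "?W \<subseteq> M"
    by (auto simp: wdeg_def intro!: add_submonoid_sum add_submonoid_mult)
qed

text \<open>A generator 0 could be dropped, since 0 lies in every submonoid. Positivity makes
  division by a variable lower the degree strictly.\<close>

lemma minimal_generators_pos:
  assumes "minimal_generators H e n" "i < e"
  shows "n i > 0"
proof (rule ccontr)
  assume "\<not> n i > 0"
  then have "0 \<in> n ` {..<e}"
    using assms(2) by force
  then have "insert 0 (n ` {..<e} - {0}) = n ` {..<e}" "n ` {..<e} - {0} \<subset> n ` {..<e}"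
    by auto
  then have "add_submonoid hull (n ` {..<e} - {0}) = add_submonoid hull (n ` {..<e})"
    using hull_redundant[OF add_submonoid_hull_zero, of "n ` {..<e} - {0}"] by simp
  then show False
    using assms(1) \<open>n ` {..<e} - {0} \<subset> n ` {..<e}\<close> unfolding minimal_generators_def by metis
qed

locale generated_numerical_semigroup =
  fixes H :: "nat set" and e :: nat and n :: "nat \<Rightarrow> nat"
  assumes semigroup: "numerical_semigroup H"
    and generators: "minimal_generators H e n"
begin

lemma H_eq: "H = wdeg n ` {u. Poly_Mapping.keys u \<subseteq> {..<e}}"
  using generators add_submonoid_hull_image[of n e] by (simp add: minimal_generators_def)

lemma wdeg_mem: "Poly_Mapping.keys u \<subseteq> {..<e} \<Longrightarrow> wdeg n u \<in> H"
  by (auto simp: H_eq)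

lemma obtain_factorization:
  assumes "h \<in> H"
  obtains u where "Poly_Mapping.keys u \<subseteq> {..<e}" "wdeg n u = h"
  using assms by (auto simp: H_eq)

lemma wdeg_eq_zero_iff:
  assumes "Poly_Mapping.keys u \<subseteq> {..<e}"
  shows "wdeg n u = 0 \<longleftrightarrow> u = 0"
proof -
  have "wdeg n u = 0 \<longleftrightarrow> (\<forall>i\<in>Poly_Mapping.keys u. n i = 0)"
    by (auto simp: wdeg_def in_keys_iff)
  also have "\<dots> \<longleftrightarrow> Poly_Mapping.keys u = {}"
    using assms minimal_generators_pos[OF generators] by fastforce
  finally show ?thesis
    by simp
qed

lemma generator_mem: "i < e \<Longrightarrow> n i \<in> H"
  using wdeg_mem[of "Poly_Mapping.single i 1"] by simp

lemma add_mem: "x \<in> H \<Longrightarrow> y \<in> H \<Longrightarrow> x + y \<in> H"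
  using semigroup by (auto simp: numerical_semigroup_def add_submonoid_def)

section \<open>Pseudo-Frobenius numbers and RF-matrices\<close>

text \<open>Take the largest \<open>h\<close> in \<open>H\<close> with \<open>x + h\<close> outside
  \<open>H\<close>; by maximality, adding any generator then leads into \<open>H\<close>.\<close>

lemma exists_PF_above:
  assumes "x \<notin> int ` H"
  shows "\<exists>h\<in>H. x + int h \<in> PF H e n"
proof -
  define T where "T = {h \<in> H. x + int h \<notin> int ` H}"
  obtain B where B: "\<And>y. y \<notin> H \<Longrightarrow> y < B"
    using semigroup finite_nat_set_iff_bounded[of "- H"] by (auto simp: numerical_semigroup_def)
  \<comment> \<open>Here \<open>x\<close> may be negative, but \<open>h\<close> beyond this bound
    makes \<open>x + h\<close> a natural number that is at least \<open>B\<close>, hence in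
    \<open>H\<close>.\<close>
  have "h < nat (int B - x)" if "h \<in> T" for h
  proof (rule ccontr)
    assume "\<not> h < nat (int B - x)"
    then have "x + int h = int (nat (x + int h))" "\<not> nat (x + int h) < B"
      by linarith+
    with B that show False
      unfolding T_def by (metis (lifting) image_eqI mem_Collect_eq)
  qed
  then have "finite T"
    using finite_nat_set_iff_bounded by blast
  have "0 \<in> T"
    using assms semigroup by (simp add: T_def numerical_semigroup_def add_submonoid_def)
  define h where "h = Max T"
  have h: "h \<in> T"
    unfolding h_def using \<open>finite T\<close> \<open>0 \<in> T\<close> by (intro Max_in) auto
  have "x + int h + int (n i) \<in> int ` H" if "i < e" for i
  proof (rule ccontr)
    assume "x + int h + int (n i) \<notin> int ` H"
    then have "h + n i \<in> T"
      using h generator_mem[OF that] by (simp add: T_def add_mem add.assoc)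
    then have "h + n i \<le> h"
      unfolding h_def by (rule Max_ge[OF \<open>finite T\<close>])
    then show False
      using minimal_generators_pos[OF generators that] by simp
  qed
  with h show ?thesis
    by (auto simp: T_def PF_def)
qed

text \<open>A factorization of \<open>f + n\<^sub>k\<close> never involves \<open>x\<^sub>k\<close>, because \<open>f \<notin> H\<close>. So any choice of
  factorizations \<open>a\<^sub>k\<close> of the numbers \<open>f + n\<^sub>k\<close> yields an RF-matrix.\<close>

lemma RF_matrix_of_factorizations:
  assumes f: "f \<notin> int ` H"
    and keys: "\<And>k. k < e \<Longrightarrow> Poly_Mapping.keys (a k) \<subseteq> {..<e}"
    and deg: "\<And>k. k < e \<Longrightarrow> int (wdeg n (a k)) = f + int (n k)"
  shows "RF_matrix e n f (\<lambda>k l. int (Poly_Mapping.lookup (a k) l) - (if l = k then 1 else 0))"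
  unfolding RF_matrix_def
proof (intro conjI allI impI)
  fix k assume k: "k < e"
  have "k \<notin> Poly_Mapping.keys (a k)"
  proof
    assume "k \<in> Poly_Mapping.keys (a k)"
    then obtain u where u: "a k = Poly_Mapping.single k 1 + u"
      by (rule obtain_single_add)
    then have "Poly_Mapping.keys u \<subseteq> {..<e}" "f = int (wdeg n u)"
      using keys[OF k] deg[OF k] by (auto simp: keys_add_nat wdeg_add)
    with f wdeg_mem show False
      by blast
  qed
  then show "int (Poly_Mapping.lookup (a k) k) - (if k = k then 1 else 0) = - 1"
    by (simp add: in_keys_iff)
  show "(\<Sum>j<e. (int (Poly_Mapping.lookup (a k) j) - (if j = k then 1 else 0)) * int (n j)) = f"
  proof -
    have "(\<Sum>j<e. (int (Poly_Mapping.lookup (a k) j) - (if j = k then 1 else 0)) * int (n j)) =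
        (\<Sum>j<e. int (Poly_Mapping.lookup (a k) j * n j) - (if j = k then int (n j) else 0))"
      by (intro sum.cong) (auto simp: left_diff_distrib)
    also have "\<dots> = int (wdeg n (a k)) - int (n k)"
      using k keys[OF k] by (simp add: sum_subtractf wdeg_eq_sum)
    finally show ?thesis
      using deg[OF k] by simp
  qed
qed auto

lemma binomial_mem_RF_relations:
  assumes u: "Poly_Mapping.keys u \<subseteq> {..<e}" and w: "Poly_Mapping.keys w \<subseteq> {..<e}"
    and deg: "wdeg n u = wdeg n w"
    and disj: "Poly_Mapping.keys u \<inter> Poly_Mapping.keys w = {}"
    and i: "i \<in> Poly_Mapping.keys u" and j: "j \<in> Poly_Mapping.keys w"
    and gap: "int (wdeg n u) - int (n i) - int (n j) \<notin> int ` H"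
  shows "Poly_Mapping.single u 1 - Poly_Mapping.single w 1 \<in>
    (RF_relations H e n :: 'k::field mpoly set)"
proof -
  obtain h where "h \<in> H" and PF: "int (wdeg n u) - int (n i) - int (n j) + int h \<in> PF H e n"
    using exists_PF_above[OF gap] by blast
  define f where "f = int (wdeg n u) - int (n i) - int (n j) + int h"
  obtain c where c: "Poly_Mapping.keys c \<subseteq> {..<e}" "wdeg n c = h"
    using \<open>h \<in> H\<close> by (rule obtain_factorization)
  obtain u' where u': "u = Poly_Mapping.single i 1 + u'"
    using i by (rule obtain_single_add)
  obtain w' where w': "w = Poly_Mapping.single j 1 + w'"
    using j by (rule obtain_single_add)
  have ij: "i < e" "j < e" "i \<noteq> j"
    using i j u w disj by auto
  have "f \<in> PF H e n"
    using PF by (simp add: f_def)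
  then have f: "f \<notin> int ` H" and "\<forall>k<e. f + int (n k) \<in> int ` H"
    by (auto simp: PF_def)
  then have "\<forall>k<e. \<exists>a. Poly_Mapping.keys a \<subseteq> {..<e} \<and> int (wdeg n a) = f + int (n k)"
    by (force simp: H_eq)
  then obtain g where g: "\<And>k. k < e \<Longrightarrow> Poly_Mapping.keys (g k) \<subseteq> {..<e}"
      "\<And>k. k < e \<Longrightarrow> int (wdeg n (g k)) = f + int (n k)"
    by metis
  \<comment> \<open>Only rows \<open>i\<close> and \<open>j\<close> are prescribed; the others come
    from arbitrary factorizations \<open>g k\<close> of \<open>f + n k\<close>.\<close>
  define a where "a = g(i := w' + c, j := u' + c)"
  define m where "m = (\<lambda>k l. int (Poly_Mapping.lookup (a k) l) - (if l = k then 1 else 0))"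
  have RF: "RF_matrix e n f m"
    unfolding m_def
  proof (rule RF_matrix_of_factorizations[OF f])
    show "Poly_Mapping.keys (a k) \<subseteq> {..<e}" if "k < e" for k
      using that u w c by (auto simp: a_def u' w' keys_add_nat dest: g(1))
    show "int (wdeg n (a k)) = f + int (n k)" if "k < e" for k
      using that g(2)[OF that] deg c by (auto simp: a_def f_def u' w' wdeg_add)
  qed
  \<comment> \<open>The summand \<open>c\<close> cancels, and the diagonal corrections restore the
    variables \<open>x_i\<close> and \<open>x_j\<close> removed from \<open>u\<close> and
    \<open>w\<close>.\<close>
  have "(\<lambda>l. m j l - m i l) = (\<lambda>l. int (Poly_Mapping.lookup u l) - int (Poly_Mapping.lookup w l))"
    using ij by (auto simp: m_def a_def u' w' lookup_add lookup_single when_def fun_eq_iff)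
  then have "Poly_Mapping.single u 1 - Poly_Mapping.single w 1 =
      (F_binomial e (\<lambda>l. m j l - m i l) :: 'k mpoly)"
    by (simp only: F_binomial_disjoint[OF u w disj])
  then show ?thesis
    unfolding RF_relations_def using \<open>f \<in> PF H e n\<close> RF ij by blast
qed

section \<open>Congruence of monomials of equal degree\<close>

lemma binomial_mem_ideal:
  fixes J :: "'k::field mpoly set"
  assumes J: "ideal J (poly_ring e)" and RF: "RF_relations H e n \<subseteq> J"
  assumes "Poly_Mapping.keys u \<subseteq> {..<e}" "Poly_Mapping.keys w \<subseteq> {..<e}" "wdeg n u = wdeg n w"
  shows "Poly_Mapping.single u 1 - Poly_Mapping.single w 1 \<in> J"
  using assms(3-)
proof (induction "wdeg n u" arbitrary: u w rule: less_induct)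
  case less
  \<comment> \<open>Stated for arbitrary \<open>s\<close> and \<open>t\<close> of the current
    degree, because it is also applied to an intermediate monomial \<open>v\<close>.\<close>
  have common: "Poly_Mapping.single s 1 - Poly_Mapping.single t 1 \<in> J"
    if s: "Poly_Mapping.keys s \<subseteq> {..<e}" "wdeg n s = wdeg n u"
      and t: "Poly_Mapping.keys t \<subseteq> {..<e}" "wdeg n t = wdeg n u"
      and k: "k \<in> Poly_Mapping.keys s" "k \<in> Poly_Mapping.keys t" for s t k
  proof -
    obtain s' t' where s': "s = Poly_Mapping.single k 1 + s'" and t': "t = Poly_Mapping.single k 1 + t'"
      using k by (meson obtain_single_add)
    have "n k > 0"
      using minimal_generators_pos[OF generators] s k by blast
    then have "Poly_Mapping.single s' 1 - Poly_Mapping.single t' 1 \<in> J"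
      using s t by (intro less.hyps) (auto simp: s' t' wdeg_add keys_add_nat)
    then have "Poly_Mapping.single (Poly_Mapping.single k 1) 1 *
        (Poly_Mapping.single s' 1 - Poly_Mapping.single t' 1) \<in> J"
      using s k by (intro ideal_mult[OF J] single_mem_carrier) auto
    then show ?thesis
      by (simp add: s' t' right_diff_distrib mult_single)
  qed
  show ?case
  proof (cases "u = w")
    case True
    then show ?thesis by (simp add: ideal_zero[OF J])
  next
    case False
    \<comment> \<open>Only the zero exponent vector has degree 0, so if one of \<open>u\<close>,
      \<open>w\<close> were zero, both would be.\<close>
    then have "u \<noteq> 0" "w \<noteq> 0"
      using less.prems wdeg_eq_zero_iff by auto
    then obtain i j where i: "i \<in> Poly_Mapping.keys u" and j: "j \<in> Poly_Mapping.keys w"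
      unfolding keys_eq_empty[symmetric] by blast
    consider (same) k where "k \<in> Poly_Mapping.keys u" "k \<in> Poly_Mapping.keys w"
      | (connected) h where "h \<in> H" "int (wdeg n u) - int (n i) - int (n j) = int h"
      | (relation) "Poly_Mapping.keys u \<inter> Poly_Mapping.keys w = {}"
          "int (wdeg n u) - int (n i) - int (n j) \<notin> int ` H"
      by blast
    then show ?thesis
    proof cases
      case same
      then show ?thesis
        using less.prems by (intro common[of _ _ k]) auto
    next
      case connected
      obtain d where d: "Poly_Mapping.keys d \<subseteq> {..<e}" "wdeg n d = h"
        using connected(1) by (rule obtain_factorization)
      \<comment> \<open>This monomial shares \<open>x_i\<close> with \<open>u\<close> and
        \<open>x_j\<close> with \<open>w\<close>, so the two binomials through \<open>v\<close> add
        up to the required one.\<close>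
      define v where "v = Poly_Mapping.single i 1 + Poly_Mapping.single j 1 + d"
      have v: "Poly_Mapping.keys v \<subseteq> {..<e}" "wdeg n v = wdeg n u"
          "i \<in> Poly_Mapping.keys v" "j \<in> Poly_Mapping.keys v"
        using d i j less.prems connected(2) by (auto simp: v_def keys_add_nat wdeg_add)
      have "Poly_Mapping.single u 1 - Poly_Mapping.single v 1 \<in> J"
        by (rule common[of _ _ i]) (use less.prems v i in auto)
      moreover have "Poly_Mapping.single v 1 - Poly_Mapping.single w 1 \<in> J"
        by (rule common[of _ _ j]) (use less.prems v j in auto)
      ultimately show ?thesis
        using ideal_add[OF J] by fastforce
    next
      case relation
      then show ?thesis
        using binomial_mem_RF_relations less.prems i j RF by blast
    qed
  qed
qed

end

theorem corollary3p5:
  fixes H :: "nat set" and e :: nat and n :: "nat \<Rightarrow> nat"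
  assumes "numerical_semigroup H"
    and "minimal_generators H e n"
  shows "(toric_ideal e n :: 'k::field mpoly set) =
    Idl\<^bsub>poly_ring e\<^esub> (RF_relations H e n)"
proof
  interpret generated_numerical_semigroup H e n
    using assms by unfold_locales
  interpret R: cring "poly_ring e :: 'k mpoly ring"
    by (rule cring_poly_ring)
  show "Idl\<^bsub>poly_ring e\<^esub> (RF_relations H e n) \<subseteq> (toric_ideal e n :: 'k mpoly set)"
    by (rule R.genideal_minimal[OF ideal_toric_ideal RF_relations_subset_toric_ideal])
  \<comment> \<open>Generators inside the carrier make the generated set an ideal containing them,
    so it can serve as \<open>J\<close>.\<close>
  have "(RF_relations H e n :: 'k mpoly set) \<subseteq> carrier (poly_ring e)"
    using RF_relations_subset_toric_ideal by (fastforce simp: toric_ideal_def)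
  note J = R.genideal_ideal[OF this] and RF = R.genideal_self[OF this]
  show "(toric_ideal e n :: 'k mpoly set) \<subseteq> Idl\<^bsub>poly_ring e\<^esub> (RF_relations H e n)"
    by (intro toric_ideal_subset_ideal[OF J] binomial_mem_ideal[OF J RF])
qed

end
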